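(* Let $0< \varepsilon \le 1/2$ and $k \in \mathbb{N}$. Every edge-coloured bipartite graph $G$ on $n \ge (3+ \varepsilon)k + \varepsilon^{-2}$ vertices with $\delta^c(G) \geq k$ contains a rainbow matching of size $k$.
   Context: Graphs are simple. An edge-coloured graph is a graph in which each edge is assigned a colour (not necessarily properly). A subgraph is rainbow if all its edges have distinct colours. For a vertex $v$, the colour degree $d^c(v)$ is the number of distinct colours on the edges incident with $v$; $\delta^c(G)=\min_{v\in V(G)} d^c(v)$. *)

theory Defs
  imports Complex_Main
begin

text \<open>
  A graph is given by its vertex set \<open>V\<close> and its edge set \<open>E\<close>, an undirected edge being the
  two-element set of its endpoints. An edge-colouring is a function \<open>c\<close> on sets of vertices, of
  which only the values on \<open>E\<close> are relevant; it need not be proper.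
\<close>

definition simple_graph :: "'v set \<Rightarrow> 'v set set \<Rightarrow> bool" where
  "simple_graph V E \<longleftrightarrow> finite V \<and> (\<forall>e\<in>E. e \<subseteq> V \<and> card e = 2)"

definition bipartite :: "'v set \<Rightarrow> 'v set set \<Rightarrow> bool" where
  "bipartite V E \<longleftrightarrow>
    (\<exists>A B. A \<union> B = V \<and> A \<inter> B = {} \<and> (\<forall>e\<in>E. \<exists>a\<in>A. \<exists>b\<in>B. e = {a, b}))"

definition colour_degree :: "'v set set \<Rightarrow> ('v set \<Rightarrow> 'c) \<Rightarrow> 'v \<Rightarrow> nat" where
  "colour_degree E c v = card (c ` {e \<in> E. v \<in> e})"

text \<open>Only meaningful for finite nonempty \<open>V\<close>, as \<^const>\<open>Min\<close> is unspecified on the empty set.\<close>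

definition min_colour_degree :: "'v set \<Rightarrow> 'v set set \<Rightarrow> ('v set \<Rightarrow> 'c) \<Rightarrow> nat" where
  "min_colour_degree V E c = Min (colour_degree E c ` V)"

definition matching :: "'v set set \<Rightarrow> 'v set set \<Rightarrow> bool" where
  "matching E M \<longleftrightarrow> M \<subseteq> E \<and> pairwise disjnt M"

definition rainbow :: "('v set \<Rightarrow> 'c) \<Rightarrow> 'v set set \<Rightarrow> bool" where
  "rainbow c F \<longleftrightarrow> inj_on c F"

end

theory Submission
  imports Defs "HOL-Library.Disjoint_Sets"
begin

text \<open>
  Let \<open>M\<close> be a rainbow matching of size less than \<open>k\<close> that cannot be enlarged. Take a largest set
  \<open>T\<close> of edges of \<open>M\<close>, each \<open>e\<close> in \<open>T\<close> carrying an edge \<open>d e\<close> from a vertex outside \<open>M\<close> to an end of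
  \<open>e\<close>, such that these outer vertices are distinct, and the colour of \<open>d e\<close> is either absent from
  \<open>M\<close> or the colour of an edge added to \<open>T\<close> earlier. Switching along a branch of this forest
  releases any chosen colour of \<open>T\<close> and preserves the size.

  Consider a vertex \<open>w\<close> that neither \<open>M\<close> nor any \<open>d e\<close> covers. It sees more than \<open>card T\<close> colours that
  are absent from \<open>M\<close> or belong to \<open>T\<close>, and by maximality the corresponding edges end in the edges
  \<open>e\<close> of \<open>T\<close> or in the outer vertices of the \<open>d e\<close>. On the side opposite to \<open>w\<close> each \<open>e\<close> offers at
  most one end of either kind. If two such vertices \<open>w1\<close>, \<open>w2\<close> lie on the same side, then \<open>w1\<close>
  cannot reach \<open>e\<close> while \<open>w2\<close> reaches the outer vertex of \<open>d e\<close>: replacing \<open>d e\<close> by the edge from \<open>w1\<close>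
  would free that outer vertex and lead to an augmentation. Counting this for both orders of
  \<open>w1\<close>, \<open>w2\<close> gives a contradiction, so each side contains at most one uncovered vertex and \<open>V\<close> has
  at most \<open>3 * card M + 2\<close> vertices. In particular \<open>3 * k\<close> vertices suffice.
\<close>

section \<open>Rainbow matchings, chains and switchings\<close>

lemma rainbow_insert: "rainbow c N \<Longrightarrow> c f \<notin> c ` N \<Longrightarrow> rainbow c (insert f N)"
  unfolding rainbow_def inj_on_insert by blast

text \<open>Maximality refers to size, not inclusion, since a matching obtained after switching need
  not contain \<open>M\<close>.\<close>

locale maximal_rainbow_matching =
  fixes V :: "'v set" and E :: "'v set set" and c :: "'v set \<Rightarrow> 'c" and M :: "'v set set"
  assumes simple: "simple_graph V E"
    and matching: "matching E M"
    and rainbow: "rainbow c M"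
    and maximal: "\<And>N. matching E N \<Longrightarrow> rainbow c N \<Longrightarrow> card N \<noteq> Suc (card M)"
begin

lemma edgeD: "e \<in> E \<Longrightarrow> e \<subseteq> V \<and> card e = 2 \<and> finite e"
  using simple by (auto simp: simple_graph_def intro: card_ge_0_finite)

lemma finite_V: "finite V"
  using simple by (simp add: simple_graph_def)

lemma M_subset: "M \<subseteq> E"
  using matching by (simp add: matching_def)

lemma finite_M: "finite M"
proof (rule finite_subset)
  show "M \<subseteq> Pow V" using M_subset edgeD by blast
qed (simp add: finite_V)

lemma M_unique: "e \<in> M \<Longrightarrow> f \<in> M \<Longrightarrow> x \<in> e \<Longrightarrow> x \<in> f \<Longrightarrow> e = f"
  using matching by (auto simp: matching_def pairwise_def disjnt_def)

lemma c_inj: "e \<in> M \<Longrightarrow> f \<in> M \<Longrightarrow> c e = c f \<Longrightarrow> e = f"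
  using rainbow by (auto simp: rainbow_def inj_on_def)

text \<open>A chain is a branch of the forest: replacing every edge \<open>e\<close> of the list by \<open>d e\<close> uses one colour outside \<open>M\<close> and releases
  the colour \<open>t\<close>.\<close>

inductive chain :: "'v set set \<Rightarrow> ('v set \<Rightarrow> 'v set) \<Rightarrow> 'c \<Rightarrow> 'v set list \<Rightarrow> bool" for T d where
  Nil: "t \<notin> c ` M \<Longrightarrow> chain T d t []"
| Cons: "e \<in> T \<Longrightarrow> chain T d (c (d e)) xs \<Longrightarrow> chain T d (c e) (e # xs)"

text \<open>The required chains are finite, so following \<open>c (d e)\<close> from edge to edge
  never cycles and ends at a colour absent from \<open>M\<close>. This replaces an explicit order in
  which the edges were added to \<open>T\<close>.\<close>

definition switching :: "'v set set \<Rightarrow> ('v set \<Rightarrow> 'v set) \<Rightarrow> bool" where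
  "switching T d \<longleftrightarrow> T \<subseteq> M \<and> disjoint_family_on d T \<and>
    (\<forall>e\<in>T. d e \<in> E \<and> (\<exists>w v. d e = {w, v} \<and> w \<notin> \<Union>M \<and> v \<in> e) \<and> (\<exists>xs. chain T d (c e) xs))"

definition free :: "'v set set \<Rightarrow> ('v set \<Rightarrow> 'v set) \<Rightarrow> 'v set" where
  "free T d = V - \<Union>M - \<Union>(d ` T)"

lemma chain_subset: "chain T d t xs \<Longrightarrow> set xs \<subseteq> T"
  by (induction rule: chain.induct) auto

lemma chain_cong:
  assumes "chain T d t xs" and "\<And>e. e \<in> set xs \<Longrightarrow> e \<in> T' \<and> d' e = d e"
  shows "chain T' d' t xs"
  using assms
proof (induction rule: chain.induct)
  case (Cons e xs)
  then have "chain T' d' (c (d' e)) xs" by simp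
  then show ?case using Cons.prems chain.Cons by simp
qed (simp add: chain.Nil)

text \<open>As \<open>M\<close> is rainbow, the colour \<open>t\<close> determines the head
  \<open>e\<close>, and then \<open>c (d e)\<close> determines the rest.\<close>

lemma chain_unique:
  assumes "T \<subseteq> M" and "chain T d t xs" and "chain T d t ys"
  shows "xs = ys"
  using assms(2,3)
proof (induction arbitrary: ys rule: chain.induct)
  case (Nil t)
  from Nil(2) show ?case
    by cases (use Nil(1) assms(1) in auto)
next
  case (Cons e xs)
  from Cons.prems show ?case
  proof cases
    case Nil
    then show ?thesis using Cons.hyps assms(1) by auto
  next
    case (Cons e' zs)
    then have "e' = e" using c_inj \<open>e \<in> T\<close> assms(1) by (metis subsetD)
    then show ?thesis using Cons Cons.IH by simp
  qed
qed

lemma chain_suffix: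
  assumes "chain T d t xs" and "e \<in> set xs"
  shows "\<exists>ys. chain T d (c e) (e # ys) \<and> length ys < length xs"
  using assms
proof (induction rule: chain.induct)
  case (Cons f xs)
  show ?case
  proof (cases "e = f")
    case True
    then show ?thesis using Cons.hyps chain.Cons by fastforce
  next
    case False
    then show ?thesis using Cons by fastforce
  qed
qed simp

text \<open>A second occurrence of \<open>e\<close> would start a chain for \<open>c e\<close>
  shorter than \<open>e # xs\<close>, against uniqueness.\<close>

lemma chain_notin:
  assumes "T \<subseteq> M" and "e \<in> T" and "chain T d (c (d e)) xs"
  shows "e \<notin> set xs"
proof
  assume "e \<in> set xs"
  then obtain ys where "chain T d (c e) (e # ys)" "length ys < length xs"
    using chain_suffix[OF assms(3)] by blast
  moreover have "chain T d (c e) (e # xs)" using assms chain.Cons by simp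
  ultimately show False using chain_unique[OF assms(1)] by blast
qed

lemma switching_chain:
  assumes "switching T d" and "t \<notin> c ` (M - T)"
  shows "\<exists>xs. chain T d t xs"
proof (cases "t \<in> c ` M")
  case True
  then show ?thesis using assms by (auto simp: switching_def)
qed (use chain.Nil in blast)

lemma switching_disjoint:
  "switching T d \<Longrightarrow> e \<in> T \<Longrightarrow> f \<in> T \<Longrightarrow> e \<noteq> f \<Longrightarrow> d e \<inter> d f = {}"
  by (auto simp: switching_def disjoint_family_on_def)

lemma switchingD:
  assumes "switching T d" and "e \<in> T"
  shows "e \<in> M" and "d e \<in> E"
    and "\<exists>w v. d e = {w, v} \<and> w \<notin> \<Union>M \<and> v \<in> e"
  using assms by (auto simp: switching_def)

section \<open>Switching along a chain and augmentation\<close>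

text \<open>Induction from the far end of the chain: once \<open>c (d e)\<close> is released,
  \<open>d e\<close> can replace \<open>e\<close>, the only edge it meets, and this releases
  \<open>c e\<close>.\<close>

lemma switch_matching:
  assumes "switching T d" and "chain T d t xs"
  defines "N \<equiv> (M - set xs) \<union> d ` set xs"
  shows "matching E N \<and> rainbow c N \<and> card N = card M \<and> t \<notin> c ` N"
  using assms(2) unfolding N_def
proof (induction rule: chain.induct)
  case (Nil t)
  then show ?case using matching rainbow by simp
next
  case (Cons e xs)
  let ?N = "(M - set xs) \<union> d ` set xs"
  have TM: "T \<subseteq> M" using assms(1) by (simp add: switching_def)
  have xsT: "set xs \<subseteq> T" using Cons.hyps chain_subset by blast
  have e_new: "e \<notin> set xs" using chain_notin[OF TM] Cons.hyps by blast
  have eN: "e \<in> ?N" using e_new Cons.hyps TM by blast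
  obtain w v where wv: "d e = {w, v}" "w \<notin> \<Union>M" "v \<in> e"
    using switchingD(3)[OF assms(1) \<open>e \<in> T\<close>] by blast
  \<comment> \<open>Both ends of \<open>e\<close> are covered by \<open>M\<close>, whereas every
    \<open>d f\<close> has an outer vertex.\<close>
  have e_notin_d: "e \<notin> d ` set xs"
  proof
    assume "e \<in> d ` set xs"
    then obtain f where f: "f \<in> T" "e = d f" using xsT by blast
    obtain w' v' where "d f = {w', v'}" "w' \<notin> \<Union>M"
      using switchingD(3)[OF assms(1) f(1)] by blast
    then show False using f(2) TM \<open>e \<in> T\<close> by blast
  qed
  have disj: "disjnt (d e) g" if "g \<in> ?N - {e}" for g
  proof (cases "g \<in> d ` set xs")
    case True
    then obtain f where "f \<in> set xs" "g = d f" by blast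
    then show ?thesis
      using switching_disjoint[OF assms(1) \<open>e \<in> T\<close>] xsT e_new by (auto simp: disjnt_def)
  next
    case False
    then have g: "g \<in> M" "g \<noteq> e" using that by auto
    have "w \<notin> g" using wv g by blast
    moreover have "v \<notin> g" using M_unique[of e g v] wv g TM \<open>e \<in> T\<close> by blast
    ultimately show ?thesis using wv by (simp add: disjnt_def)
  qed
  have eq: "(M - set (e # xs)) \<union> d ` set (e # xs) = insert (d e) (?N - {e})"
    using e_notin_d by auto
  have IH: "matching E ?N" "rainbow c ?N" "card ?N = card M" "c (d e) \<notin> c ` ?N"
    using Cons.IH by auto
  have "matching E (insert (d e) (?N - {e}))"
    unfolding matching_def pairwise_insert
    using IH(1) disj switchingD(2)[OF assms(1) \<open>e \<in> T\<close>]
    by (auto simp: matching_def pairwise_def disjnt_sym)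
  moreover have "rainbow c (insert (d e) (?N - {e}))"
    using IH(2,4) by (intro rainbow_insert) (auto simp: rainbow_def inj_on_diff)
  moreover have "card (insert (d e) (?N - {e})) = card M"
  proof -
    have "finite ?N" using finite_M by simp
    moreover have "d e \<notin> ?N" using IH(4) by blast
    ultimately show ?thesis using eN IH(3) by (metis card_Suc_Diff1 card_insert_disjoint
          finite_Diff DiffD1)
  qed
  moreover have "c e \<notin> c ` (insert (d e) (?N - {e}))"
  proof -
    have "c e \<noteq> c (d e)" using IH(4) eN by (metis imageI)
    moreover have "c e \<notin> c ` (?N - {e})"
      using IH(2) eN unfolding rainbow_def inj_on_def by blast
    ultimately show ?thesis by simp
  qed
  ultimately show ?case unfolding eq by blast
qed

text \<open>The edges in \<open>xs\<close> leave the matching, so \<open>f\<close> may meet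
  them.\<close>

lemma no_augmentation:
  assumes "switching T d" and "chain T d (c f) xs" and "f \<in> E"
    and "\<And>e. e \<in> M - set xs \<Longrightarrow> f \<inter> e = {}" and "\<And>e. e \<in> set xs \<Longrightarrow> f \<inter> d e = {}"
  shows False
proof -
  let ?N = "(M - set xs) \<union> d ` set xs"
  have N: "matching E ?N" "rainbow c ?N" "card ?N = card M" "c f \<notin> c ` ?N"
    using switch_matching[OF assms(1,2)] by auto
  have "matching E (insert f ?N)"
    unfolding matching_def pairwise_insert
    using N(1) assms(3-5) by (auto simp: matching_def disjnt_def)
  moreover have "rainbow c (insert f ?N)"
    using N(2,4) by (rule rainbow_insert)
  moreover have "card (insert f ?N) = Suc (card M)"
    using N(3,4) finite_M by (subst card_insert_disjoint) auto
  ultimately show False using maximal by blast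
qed

lemma no_free_edge:
  assumes "switching T d" and "c f \<notin> c ` (M - T)" and "f \<in> E" and "f \<subseteq> free T d"
  shows False
proof -
  obtain xs where xs: "chain T d (c f) xs" using switching_chain[OF assms(1,2)] by blast
  show False
    by (rule no_augmentation[OF assms(1) xs assms(3)])
      (use assms(4) chain_subset[OF xs] in \<open>auto simp: free_def\<close>)
qed

section \<open>Enlarging and redirecting a switching\<close>

text \<open>Old chains avoid \<open>f\<close> and survive; the chain for \<open>c f\<close> is
  \<open>f\<close> followed by one for \<open>c {w, b}\<close>.\<close>

lemma switching_insert:
  assumes "switching T d" and "f \<in> M - T" and "w \<in> free T d" and "b \<in> f" and "{w, b} \<in> E"
    and "c {w, b} \<notin> c ` (M - T)"
  shows "switching (insert f T) (d(f := {w, b}))"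
proof -
  let ?T = "insert f T" and ?d = "d(f := {w, b})"
  have TM: "T \<subseteq> M" using assms(1) by (simp add: switching_def)
  have mono: "chain ?T ?d t xs" if "chain T d t xs" for t xs
    using that by (rule chain_cong) (use chain_subset[OF that] assms(2) in auto)
  obtain us where "chain T d (c {w, b}) us"
    using switching_chain[OF assms(1,6)] by blast
  then have f_chain: "chain ?T ?d (c f) (f # us)"
    using mono by (intro chain.Cons) auto
  have disj: "d e \<inter> {w, b} = {}" if "e \<in> T" for e
  proof -
    obtain w' v' where e: "d e = {w', v'}" "w' \<notin> \<Union>M" "v' \<in> e"
      using switchingD(3)[OF assms(1) \<open>e \<in> T\<close>] by blast
    have "b \<noteq> w'" using e assms(2,4) by blast
    moreover have "b \<noteq> v'" using M_unique[of e f b] e assms(2,4) that TM by blast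
    moreover have "w \<notin> d e" using assms(3) that by (auto simp: free_def)
    ultimately show ?thesis using e by blast
  qed
  have "disjoint_family_on ?d ?T"
    using assms(1,2) disj unfolding switching_def disjoint_family_on_def
    by (auto simp: Int_commute)
  moreover have "w \<notin> \<Union>M" using assms(3) by (simp add: free_def)
  moreover have "\<exists>xs. chain ?T ?d (c e) xs" if "e \<in> T" for e
    using that mono assms(1) by (meson switching_def)
  ultimately show ?thesis
    using assms f_chain TM unfolding switching_def by (auto simp: doubleton_eq_iff)
qed

text \<open>Since \<open>us\<close> avoids \<open>e\<close>, the new branch \<open>e # us\<close>
  has no cycle. Old chains through \<open>e\<close> continue along it from there.\<close>

lemma switching_redirect:
  assumes "switching T d" and "e \<in> T" and "w \<in> free T d" and "y \<in> e" and "{w, y} \<in> E"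
    and "chain T d (c {w, y}) us" and "e \<notin> set us"
  shows "switching T (d(e := {w, y}))"
proof -
  let ?d = "d(e := {w, y})"
  have TM: "T \<subseteq> M" using assms(1) by (simp add: switching_def)
  have "chain T ?d (c {w, y}) us"
    using assms(6) by (rule chain_cong) (use chain_subset[OF assms(6)] assms(7) in auto)
  then have e_chain: "chain T ?d (c e) (e # us)"
    using assms(2) by (intro chain.Cons) auto
  have ex: "\<exists>ys. chain T ?d t ys" if "chain T d t xs" for t xs
    using that
  proof (induction rule: chain.induct)
    case (Cons f xs)
    show ?case
    proof (cases "f = e")
      case True
      then show ?thesis using e_chain by blast
    next
      case False
      then have "?d f = d f" by simp
      then obtain ys where "chain T ?d (c (?d f)) ys" using Cons.IH by metis
      then show ?thesis using chain.Cons Cons.hyps(1) by blast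
    qed
  qed (auto intro: chain.Nil)
  have disj: "d f \<inter> {w, y} = {}" if "f \<in> T" "f \<noteq> e" for f
  proof -
    obtain w' v' where f: "d f = {w', v'}" "w' \<notin> \<Union>M" "v' \<in> f"
      using switchingD(3)[OF assms(1) \<open>f \<in> T\<close>] by blast
    have "y \<noteq> w'" using f assms(2,4) TM by blast
    moreover have "y \<noteq> v'" using M_unique[of e f y] f assms(2,4) that TM by blast
    moreover have "w \<notin> d f" using assms(3) that by (auto simp: free_def)
    ultimately show ?thesis using f by blast
  qed
  have "disjoint_family_on ?d T"
    using assms(1) disj unfolding switching_def disjoint_family_on_def
    by (auto simp: Int_commute)
  moreover have "w \<notin> \<Union>M" using assms(3) by (simp add: free_def)
  moreover have "\<exists>xs. chain T ?d (c f) xs" if "f \<in> T" for f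
    using that ex assms(1) by (meson switching_def)
  ultimately show ?thesis
    using assms TM unfolding switching_def by (auto simp: doubleton_eq_iff)
qed

section \<open>Counting colours at a free vertex\<close>

text \<open>The condition is invariant under replacing \<open>S\<close> by its complement, so
  results for one side transfer to the other.\<close>

definition bipartition :: "'v set \<Rightarrow> bool" where
  "bipartition S \<longleftrightarrow> (\<forall>e\<in>E. \<exists>a b. a \<in> S \<and> b \<notin> S \<and> e = {a, b})"

text \<open>When \<open>T\<close> is part of a switching, every colour outside \<open>c ` (M - T)\<close> can be released.\<close>

definition usable :: "'v set set \<Rightarrow> 'v \<Rightarrow> 'v \<Rightarrow> bool" where
  "usable T w b \<longleftrightarrow> {w, b} \<in> E \<and> c {w, b} \<notin> c ` (M - T)"

definition reach :: "'v set \<Rightarrow> 'v set set \<Rightarrow> 'v \<Rightarrow> 'v set set" where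
  "reach S T w = {e \<in> T. \<exists>b\<in>e - S. usable T w b}"

text \<open>For a switching, \<open>d e - e\<close> consists of just the outer vertex of
  \<open>d e\<close>.\<close>

definition reach_switch ::
  "'v set \<Rightarrow> 'v set set \<Rightarrow> ('v set \<Rightarrow> 'v set) \<Rightarrow> 'v \<Rightarrow> 'v set set" where
  "reach_switch S T d w = {e \<in> T. \<exists>b\<in>d e - e - S. usable T w b}"

lemma bipartition_card:
  assumes "bipartition S" and "e \<in> E"
  shows "card (e - S) = 1"
proof -
  obtain a b where "a \<in> S" "b \<notin> S" "e = {a, b}"
    using assms by (auto simp: bipartition_def)
  then have "e - S = {b}" by auto
  then show ?thesis by simp
qed

lemma reach_disjoint:
  assumes "bipartition S" and "switching T d"
    and "w1 \<in> free T d" and "w2 \<in> free T d" and "w1 \<in> S" and "w2 \<in> S" and "w1 \<noteq> w2"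
  shows "reach S T w1 \<inter> reach_switch S T d w2 = {}"
proof (rule ccontr)
  assume "reach S T w1 \<inter> reach_switch S T d w2 \<noteq> {}"
  then obtain e y z where e: "e \<in> T" and y: "y \<in> e" "y \<notin> S" "usable T w1 y"
    and z: "z \<in> d e" "z \<notin> e" "z \<notin> S" "usable T w2 z"
    by (auto simp: reach_def reach_switch_def)
  have TM: "T \<subseteq> M" using assms(2) by (simp add: switching_def)
  have z_out: "z \<notin> \<Union>M"
    using switchingD(3)[OF assms(2) e] z by auto
  obtain us where us: "chain T d (c {w1, y}) us"
    using switching_chain[OF assms(2)] y(3) by (auto simp: usable_def)
  have "z \<noteq> y" using y z by blast
  \<comment> \<open>The edge \<open>d e\<close> has a single vertex outside \<open>S\<close>, namely
    \<open>z\<close>.\<close>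
  have "y \<notin> d e"
    using bipartition_card[OF assms(1) switchingD(2)[OF assms(2) e]] y z \<open>z \<noteq> y\<close>
    by (metis DiffI card_1_singletonE singletonD)
  \<comment> \<open>If \<open>us\<close> passed through \<open>e\<close>, switching along it would
    uncover \<open>y\<close>, and \<open>{w1, y}\<close> would augment the result.\<close>
  have e_notin: "e \<notin> set us"
  proof
    assume e_us: "e \<in> set us"
    show False
    proof (rule no_augmentation[OF assms(2) us])
      show "{w1, y} \<in> E" using y by (simp add: usable_def)
      show "{w1, y} \<inter> f = {}" if "f \<in> M - set us" for f
        using that assms(3) M_unique[of e f y] y e TM e_us by (auto simp: free_def)
      show "{w1, y} \<inter> d f = {}" if f: "f \<in> set us" for f
      proof -
        have fT: "f \<in> T" using f chain_subset[OF us] by blast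
        obtain w v where wv: "d f = {w, v}" "w \<notin> \<Union>M" "v \<in> f"
          using switchingD(3)[OF assms(2) fT] by blast
        have "y \<noteq> w" using wv(2) y e TM by blast
        moreover have "y \<noteq> v"
        proof
          assume "y = v"
          then have "e = f" using M_unique[of e f y] y(1) wv(3) e fT TM by blast
          then show False using \<open>y = v\<close> \<open>y \<notin> d e\<close> wv(1) by simp
        qed
        ultimately have "y \<notin> d f" using wv(1) by simp
        then show ?thesis using assms(3) fT by (auto simp: free_def)
      qed
    qed
  qed
  \<comment> \<open>Among the edges of the switching only \<open>d e\<close> contains
    \<open>z\<close>. Redirecting it makes \<open>z\<close> free, so \<open>{w2, z}\<close> becomes
    a forbidden free edge.\<close>
  let ?d = "d(e := {w1, y})"
  have "switching T ?d"
    using switching_redirect[OF assms(2) e assms(3) y(1) _ us e_notin] y by (simp add: usable_def)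
  then show False
  proof (rule no_free_edge)
    show E: "{w2, z} \<in> E" and "c {w2, z} \<notin> c ` (M - T)"
      using z by (auto simp: usable_def)
    have "z \<in> V" using E edgeD by blast
    moreover have "z \<notin> d f" if "f \<in> T" "f \<noteq> e" for f
      using switching_disjoint[OF assms(2) that(1) e that(2)] z by blast
    moreover have "z \<noteq> w1" using z assms by blast
    moreover have "w2 \<noteq> y" using y assms by blast
    ultimately show "{w2, z} \<subseteq> free T ?d"
      using assms(4,7) z_out \<open>z \<noteq> y\<close> by (auto simp: free_def)
  qed
qed

text \<open>At most \<open>card M - card T\<close> colours at \<open>w\<close> are excluded, so more
  than \<open>card T\<close> remain. The ends of their edges avoid \<open>M - T\<close> and
  \<open>free T d\<close>, and each member of \<open>reach\<close> or \<open>reach_switch\<close>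
  accounts for at most one of them.\<close>

lemma reach_card:
  assumes "bipartition S" and "switching T d"
    and max: "\<And>T' d'. switching T' d' \<Longrightarrow> card T' \<le> card T"
    and w: "w \<in> free T d" "w \<in> S"
    and deg: "card M < colour_degree E c w"
  shows "card T < card (reach S T w) + card (reach_switch S T d w)"
proof -
  have TM: "T \<subseteq> M" using assms(2) by (simp add: switching_def)
  have finT: "finite T" using TM finite_M finite_subset by blast
  define C where "C = c ` {e \<in> E. w \<in> e} - c ` (M - T)"
  have "\<exists>b. b \<notin> S \<and> usable T w b \<and> c {w, b} = t" if t: "t \<in> C" for t
  proof -
    obtain e where e: "e \<in> E" "w \<in> e" "c e = t" using t unfolding C_def by blast
    then obtain a b where ab: "a \<in> S" "b \<notin> S" "e = {a, b}"
      using assms(1) unfolding bipartition_def by meson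
    then have "w = a" using e w by auto
    with ab have "b \<notin> S" "e = {w, b}" by simp_all
    then show ?thesis using e t by (auto simp: C_def usable_def)
  qed
  \<comment> \<open>One end is chosen per colour; \<open>b\<close> is injective because
    \<open>{w, b t}\<close> determines \<open>t\<close>.\<close>
  then obtain b where b: "\<And>t. t \<in> C \<Longrightarrow> b t \<notin> S \<and> usable T w (b t) \<and> c {w, b t} = t"
    by metis
  have "card T < card C"
  proof -
    have "card (c ` {e \<in> E. w \<in> e}) - card (c ` (M - T)) \<le> card C"
      unfolding C_def by (rule diff_card_le_card_Diff) (simp add: finite_M)
    moreover have "card (c ` (M - T)) \<le> card M - card T"
      using card_image_le[of "M - T" c] finite_M card_Diff_subset[OF finT TM] by simp
    moreover have "card T \<le> card M" using TM finite_M card_mono by blast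
    ultimately show ?thesis using deg by (simp add: colour_degree_def)
  qed
  also have "card C = card (b ` C)"
    by (rule card_image[symmetric]) (metis b inj_onI)
  also have "\<dots> \<le> card ((\<Union>e\<in>reach S T w. e - S) \<union> (\<Union>e\<in>reach_switch S T d w. d e - e - S))"
  proof (rule card_mono)
    show "finite ((\<Union>e\<in>reach S T w. e - S) \<union> (\<Union>e\<in>reach_switch S T d w. d e - e - S))"
    proof (rule finite_subset[OF _ finite_V])
      have "e \<subseteq> V" "d e \<subseteq> V" if "e \<in> T" for e
        using that switchingD(1,2)[OF assms(2)] M_subset edgeD by blast+
      then show "(\<Union>e\<in>reach S T w. e - S) \<union> (\<Union>e\<in>reach_switch S T d w. d e - e - S) \<subseteq> V"
        by (auto simp: reach_def reach_switch_def)
    qed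
    show "b ` C \<subseteq> (\<Union>e\<in>reach S T w. e - S) \<union> (\<Union>e\<in>reach_switch S T d w. d e - e - S)"
    proof
      fix v assume "v \<in> b ` C"
      then have v: "v \<notin> S" "usable T w v" using b by auto
      \<comment> \<open>Otherwise \<open>f\<close> could join \<open>T\<close>, against the
        maximality of \<open>card T\<close>.\<close>
      have "v \<notin> f" if f: "f \<in> M - T" for f
      proof
        assume "v \<in> f"
        then have "switching (insert f T) (d(f := {w, v}))"
          using switching_insert[OF assms(2) f w(1)] v by (simp add: usable_def)
        from max[OF this] show False using f finT by simp
      qed
      moreover have "\<not> {w, v} \<subseteq> free T d"
        using no_free_edge[OF assms(2)] v by (auto simp: usable_def)
      moreover have "v \<in> V" using v edgeD by (auto simp: usable_def)
      ultimately have "v \<in> \<Union>T \<or> v \<in> \<Union>(d ` T) - \<Union>T"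
        using w unfolding free_def by blast
      then show "v \<in> (\<Union>e\<in>reach S T w. e - S) \<union> (\<Union>e\<in>reach_switch S T d w. d e - e - S)"
        using v by (auto simp: reach_def reach_switch_def)
    qed
  qed
  also have "\<dots> \<le> card (\<Union>e\<in>reach S T w. e - S) + card (\<Union>e\<in>reach_switch S T d w. d e - e - S)"
    by (rule card_Un_le)
  also have "\<dots> \<le> (\<Sum>e\<in>reach S T w. card (e - S)) + (\<Sum>e\<in>reach_switch S T d w. card (d e - e - S))"
    using finT by (intro add_mono card_UN_le) (auto simp: reach_def reach_switch_def)
  also have "\<dots> \<le> (\<Sum>e\<in>reach S T w. 1) + (\<Sum>e\<in>reach_switch S T d w. 1)"
  proof (intro add_mono sum_mono)
    show "card (e - S) \<le> 1" if "e \<in> reach S T w" for e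
      using that bipartition_card[OF assms(1), of e] switchingD(1)[OF assms(2), of e] M_subset
      by (auto simp: reach_def)
    show "card (d e - e - S) \<le> 1" if "e \<in> reach_switch S T d w" for e
    proof -
      have "d e \<in> E" using that switchingD(2)[OF assms(2)] by (auto simp: reach_switch_def)
      moreover from this have "card (d e - e - S) \<le> card (d e - S)"
        by (intro card_mono) (use edgeD in auto)
      ultimately show ?thesis using bipartition_card[OF assms(1)] by simp
    qed
  qed
  finally show ?thesis by simp
qed

lemma free_side_unique:
  assumes "bipartition S" and "switching T d"
    and "\<And>T' d'. switching T' d' \<Longrightarrow> card T' \<le> card T"
    and "\<And>v. v \<in> V \<Longrightarrow> card M < colour_degree E c v"
    and w1: "w1 \<in> free T d" "w1 \<in> S" and w2: "w2 \<in> free T d" "w2 \<in> S"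
  shows "w1 = w2"
proof (rule ccontr)
  assume ne: "w1 \<noteq> w2"
  have finT: "finite T"
    using assms(2) finite_M finite_subset by (auto simp: switching_def)
  have le: "card (reach S T u) + card (reach_switch S T d v) \<le> card T"
    if "u \<in> {w1, w2}" "v \<in> {w1, w2}" "u \<noteq> v" for u v
  proof -
    have "reach S T u \<inter> reach_switch S T d v = {}"
      using reach_disjoint[OF assms(1,2), of u v] that w1 w2 by blast
    moreover have "finite (reach S T u)" "finite (reach_switch S T d v)"
      using finT by (auto simp: reach_def reach_switch_def)
    ultimately have "card (reach S T u) + card (reach_switch S T d v)
        = card (reach S T u \<union> reach_switch S T d v)"
      by (simp add: card_Un_disjoint)
    also have "\<dots> \<le> card T"
      using finT by (intro card_mono) (auto simp: reach_def reach_switch_def)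
    finally show ?thesis .
  qed
  have gt: "card T < card (reach S T w) + card (reach_switch S T d w)"
    if "w \<in> free T d" "w \<in> S" for w
    using assms(3) that assms(4)[of w]
    by (intro reach_card[OF assms(1,2)]) (auto simp: free_def)
  show False
    \<comment> \<open>The two upper bounds and the two lower bounds sum the same four
      cardinalities.\<close>
    using le[of w1 w2] le[of w2 w1] ne gt[OF w1] gt[OF w2] by simp
qed

section \<open>The bound on the number of vertices\<close>

lemma card_le:
  assumes "bipartition S" and deg: "\<And>v. v \<in> V \<Longrightarrow> card M < colour_degree E c v"
  shows "card V \<le> 3 * card M + 2"
proof -
  have "\<exists>T. (\<exists>d. switching T d) \<and> (\<forall>T'. (\<exists>d. switching T' d) \<longrightarrow> card T' \<le> card T)"
  \<comment> \<open>The rule asks for a strict upper bound, hence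
    \<open>Suc (card M)\<close>.\<close>
  proof (rule ex_has_greatest_nat[where k = "{}" and b = "Suc (card M)"])
    show "\<exists>d. switching {} d" by (simp add: switching_def disjoint_family_on_def)
    show "\<forall>T. (\<exists>d. switching T d) \<longrightarrow> card T < Suc (card M)"
      using finite_M card_mono by (auto simp: switching_def less_Suc_eq_le)
  qed
  then obtain T d where Td: "switching T d"
    and max: "\<And>T' d'. switching T' d' \<Longrightarrow> card T' \<le> card T"
    by blast
  have TM: "T \<subseteq> M" using Td by (simp add: switching_def)
  have finT: "finite T" using TM finite_M finite_subset by blast
  have "bipartition (- S)"
    using assms(1) unfolding bipartition_def by (metis ComplD ComplI insert_commute)
  have finF: "finite (free T d)" using finite_V by (simp add: free_def)
  have "card (free T d \<inter> S) \<le> Suc 0"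
    using free_side_unique[OF assms(1) Td max deg] finF by (subst card_le_Suc0_iff_eq) auto
  moreover have "card (free T d \<inter> - S) \<le> Suc 0"
    using free_side_unique[OF \<open>bipartition (- S)\<close> Td max deg] finF
    by (subst card_le_Suc0_iff_eq) auto
  moreover have "card (free T d) \<le> card (free T d \<inter> S) + card (free T d \<inter> - S)"
    using card_Un_le[of "free T d \<inter> S" "free T d \<inter> - S"] by (simp flip: Int_Un_distrib)
  ultimately have free2: "card (free T d) \<le> 2" by linarith
  have card_M: "card (\<Union>M) \<le> 2 * card M"
  proof -
    have "card (\<Union>M) \<le> sum card M" by (rule card_Union_le_sum_card)
    also have "\<dots> = (\<Sum>e\<in>M. 2)" using M_subset edgeD by (intro sum.cong) auto
    finally show ?thesis by simp
  qed
  have card_d: "card (\<Union>e\<in>T. d e - \<Union>M) \<le> card T"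
  proof -
    have "card (\<Union>e\<in>T. d e - \<Union>M) \<le> (\<Sum>e\<in>T. card (d e - \<Union>M))"
      by (rule card_UN_le[OF finT])
    also have "\<dots> \<le> (\<Sum>e\<in>T. 1)"
    proof (rule sum_mono)
      fix e assume e: "e \<in> T"
      obtain w v where "d e = {w, v}" "w \<notin> \<Union>M" "v \<in> e"
        using switchingD(3)[OF Td e] by blast
      then have "d e - \<Union>M = {w}" using e TM by auto
      then show "card (d e - \<Union>M) \<le> 1" by simp
    qed
    finally show ?thesis by simp
  qed
  \<comment> \<open>The three pieces have at most 2, \<open>2 * card M\<close> and
    \<open>card T\<close> vertices.\<close>
  have "V \<subseteq> free T d \<union> (\<Union>M \<union> (\<Union>e\<in>T. d e - \<Union>M))" by (auto simp: free_def)
  moreover have "finite (free T d \<union> (\<Union>M \<union> (\<Union>e\<in>T. d e - \<Union>M)))"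
    using finite_V finT finite_M M_subset edgeD switchingD(2)[OF Td] by (auto simp: free_def)
  ultimately have "card V \<le> card (free T d \<union> (\<Union>M \<union> (\<Union>e\<in>T. d e - \<Union>M)))"
    by (rule card_mono[rotated])
  also have "\<dots> \<le> card (free T d) + (card (\<Union>M) + card (\<Union>e\<in>T. d e - \<Union>M))"
    by (intro order_trans[OF card_Un_le] add_left_mono card_Un_le)
  also have "\<dots> \<le> 2 + (2 * card M + card M)"
    using free2 card_M card_d card_mono[OF finite_M TM] by linarith
  finally show ?thesis by simp
qed

end

section \<open>Rainbow matchings of size \<open>k\<close>\<close>

theorem rainbow_matching_bipartite:
  assumes simple: "simple_graph V E" and "bipartite V E"
    and n: "3 * k \<le> card V"
    and deg: "\<And>v. v \<in> V \<Longrightarrow> k \<le> colour_degree E c v"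
  shows "\<exists>M. matching E M \<and> rainbow c M \<and> card M = k"
proof (rule ccontr)
  assume contra: "\<nexists>M. matching E M \<and> rainbow c M \<and> card M = k"
  let ?P = "\<lambda>j. \<exists>M. matching E M \<and> rainbow c M \<and> card M = j"
  have "?P 0" by (intro exI[of _ "{}"]) (simp add: matching_def rainbow_def)
  \<comment> \<open>Climbing from size 0 must get stuck below \<open>k\<close>; a matching of the
    size \<open>m\<close> where it does meets the locale's maximality condition.\<close>
  have "\<exists>m<k. ?P m \<and> \<not> ?P (Suc m)"
  proof (rule ccontr)
    assume "\<not> (\<exists>m<k. ?P m \<and> \<not> ?P (Suc m))"
    then have step: "?P (Suc j)" if "j < k" "?P j" for j
      using that by blast
    have "j \<le> k \<Longrightarrow> ?P j" for j
    proof (induction j)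
      case 0
      show ?case by fact
    next
      case (Suc j)
      show ?case using step[of j] Suc by simp
    qed
    then show False using contra by blast
  qed
  then obtain m where m: "m < k" "?P m" "\<not> ?P (Suc m)" by blast
  then obtain M where M: "matching E M" "rainbow c M" "card M = m" by blast
  interpret maximal_rainbow_matching V E c M
    using simple M m(3) by unfold_locales blast+
  obtain A B where AB: "A \<inter> B = {}" "\<forall>e\<in>E. \<exists>a\<in>A. \<exists>b\<in>B. e = {a, b}"
    using assms(2) unfolding bipartite_def by blast
  have "bipartition A"
    unfolding bipartition_def
  proof
    fix e assume "e \<in> E"
    then obtain a b where "a \<in> A" "b \<in> B" "e = {a, b}" using AB(2) by blast
    moreover have "b \<notin> A" using AB(1) \<open>b \<in> B\<close> by blast
    ultimately show "\<exists>a b. a \<in> A \<and> b \<notin> A \<and> e = {a, b}" by blast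
  qed
  moreover have "card M < colour_degree E c v" if "v \<in> V" for v
    using deg[OF that] M(3) m(1) by linarith
  ultimately have "card V \<le> 3 * m + 2"
    using card_le M(3) by blast
  \<comment> \<open>From \<open>m < k\<close> follows 3 * m + 2 < 3 * k.\<close>
  then show False using m n by linarith
qed

theorem theorem1p2:
  fixes \<epsilon> :: real and k :: nat
    and V :: "'v set" and E :: "'v set set" and c :: "'v set \<Rightarrow> 'c"
  assumes "0 < \<epsilon>" and "\<epsilon> \<le> 1 / 2"
    and "simple_graph V E" and "bipartite V E"
    and "real (card V) \<ge> (3 + \<epsilon>) * real k + 1 / \<epsilon>\<^sup>2"
    and "min_colour_degree V E c \<ge> k"
  shows "\<exists>M. matching E M \<and> rainbow c M \<and> card M = k"
proof (rule rainbow_matching_bipartite[OF assms(3,4)])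
  \<comment> \<open>Dropping these two nonnegative terms leaves the bound 3 * k \<le> card
    V.\<close>
  have "0 \<le> \<epsilon> * real k" "0 \<le> 1 / \<epsilon>\<^sup>2" using assms(1) by auto
  then have "3 * real k \<le> real (card V)" using assms(5) unfolding distrib_right by linarith
  then show "3 * k \<le> card V" by linarith
  have "finite V" using assms(3) by (simp add: simple_graph_def)
  then show "k \<le> colour_degree E c v" if "v \<in> V" for v
    using assms(6) that unfolding min_colour_degree_def
    by (meson Min_le finite_imageI imageI le_trans)
qed

end
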